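(* A word identity $\mathbf{u}\approx\mathbf{v}$ holds in $(\mathsf{baxt}_2,{}^{\sharp})$ if and only if $\mathbf{u}\approx\mathbf{v}$ is balanced and satisfies that for any $x,y\in\mathsf{con}(\mathbf{u})$ with $x,x^*\neq y$, the following hold, where $Z=\{x,x^*,y,y^*\}$: (I) (a) if $\mathbf{u}[x,y]\in x^{\alpha}x^*Z^{\times}$ for some $\alpha\ge1$, then $\mathbf{v}[x,y]\in x^{\alpha}x^*Z^{\times}$; (b) if $\mathbf{u}[x,y]\in Z^{\times}x^*x^{\alpha}$ for some $\alpha\ge1$, then $\mathbf{v}[x,y]\in Z^{\times}x^*x^{\alpha}$. (II) (a) if $\mathbf{u}[x,y]\in y^{\alpha}xZ^{\times}$ for some $\alpha\ge1$, then $\mathbf{v}[x,y]\in y^{\alpha}xZ^{\times}$; (b) if $\mathbf{u}[x,y]\in Z^{\times}xy^{\alpha}$ for some $\alpha\ge1$, then $\mathbf{v}[x,y]\in Z^{\times}xy^{\alpha}$. (III) (a) if $\mathbf{u}[x,y]\in \mathbf{a}xZ^{\times}$ with $\mathsf{con}(\mathbf{a})=\{x^*,y^*\}$, then $\mathbf{v}[x,y]\in\mathbf{a}'xZ^{\times}$ or $\mathbf{v}[x,y]\in\mathbf{a}'yZ^{\times}$ where $\mathbf{a}'$ is a permutation of $\mathbf{a}$; (b) if $\mathbf{u}[x,y]\in Z^{\times}x\mathbf{a}$ with $\mathsf{con}(\mathbf{a})=\{x^*,y^*\}$, then $\mathbf{v}[x,y]\in Z^{\times}x\mathbf{a}'$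 or $\mathbf{v}[x,y]\in Z^{\times}y\mathbf{a}'$ where $\mathbf{a}'$ is a permutation of $\mathbf{a}$.
   Context: Baxter monoid: for $n\ge 1$ let $\mathcal{A}_n=\{1<2<\cdots<n\}$ and let $\mathcal{A}_n^{\star}$ be the free monoid on $\mathcal{A}_n$. Then $\mathsf{baxt}_n=\mathcal{A}_n^{\star}/\!\equiv$, where $\equiv$ is the congruence generated by all pairs $(c\mathbf{u}ad\mathbf{v}b,\ c\mathbf{u}da\mathbf{v}b)$ with $a\le b<c\le d$ and $(b\mathbf{u}da\mathbf{v}c,\ b\mathbf{u}ad\mathbf{v}c)$ with $a<b\le c<d$, where $a,b,c,d\in\mathcal{A}_n$, $\mathbf{u},\mathbf{v}\in\mathcal{A}_n^{\star}$. Schützenberger's involution $^{\sharp}$ on $\mathsf{baxt}_n$ is induced by $i^{\sharp}=n+1-i$ and $(w_1\cdots w_k)^{\sharp}=w_k^{\sharp}\cdots w_1^{\sharp}$. Words: $\mathcal{X}$ is a countably infinite alphabet, $\mathcal{X}^*=\{x^*:x\in\mathcal{X}\}$ a disjoint copy, with $(x^* )^*=x$; elements of $\mathcal{X}\cup\mathcal{X}^*$ are variables. For a set $Z$ of variables, $Z^{\times}=Z^+\cup\{\emptyset\}$ is the set of all finite words over $Z$, including the empty word $\emptyset$. $\mathsf{con}(\mathbf{u})$ is the set of variables (elements of $\mathcal{X}\cup\mathcal{X}^*$) occurring in $\mathbf{u}$; $\mathsf{occ}(x,\mathbf{u})$ is the number of occurrences of $x$ in $\mathbf{u}$ ($x$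 and $x^*$ are counted separately). $\mathbf{u}[x,y]$ is the word obtained from $\mathbf{u}$ by retaining only the variables $x,x^*,y,y^*$. A word $\mathbf{a}'$ is a permutation of $\mathbf{a}$ if $\mathsf{occ}(z,\mathbf{a})=\mathsf{occ}(z,\mathbf{a}')$ for every variable $z$. A word identity is an expression $\mathbf{u}\approx\mathbf{v}$ with $\mathbf{u},\mathbf{v}\in(\mathcal{X}\cup\mathcal{X}^* )^+$; it holds in an involution monoid $(M,{}^* )$ if for every map $\varphi:\mathcal{X}\to M$, extended by $\varphi(x^* )=\varphi(x)^*$ and multiplicatively to words, $\varphi(\mathbf{u})=\varphi(\mathbf{v})$. It is balanced if $\mathsf{occ}(x,\mathbf{u})=\mathsf{occ}(x,\mathbf{v})$ for all $x\in\mathsf{con}(\mathbf{u}\mathbf{v})$.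
   Formalization: Conditions (I)–(III) are imposed for x in con(u) and every variable y different from x and x*, not only y in con(u); as printed the claim fails for xx* ≈ x*x, which is balanced with no admissible pair, yet x ↦ 1 gives 12 and 21. *)

theory Defs
  imports "HOL-Algebra.Group" "HOL-Library.Countable" "HOL-Library.Infinite_Typeclass"
begin

section \<open>Involution monoids\<close>

locale involution_monoid = monoid M for M (structure) +
  fixes inv_op :: "'a \<Rightarrow> 'a"
  assumes inv_op_closed: "x \<in> carrier M \<Longrightarrow> inv_op x \<in> carrier M"
    and inv_op_inv_op: "x \<in> carrier M \<Longrightarrow> inv_op (inv_op x) = x"
    and inv_op_mult: "x \<in> carrier M \<Longrightarrow> y \<in> carrier M \<Longrightarrow>
      inv_op (x \<otimes> y) = inv_op y \<otimes> inv_op x"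

section \<open>The Baxter monoid of rank n and its involution\<close>

text \<open>The alphabet \<open>{1 < ... < n}\<close> is \<open>{1..n}\<close> as a set of naturals, and the free monoid on
  it is \<open>lists {1..n}\<close>.\<close>

inductive baxt_gen :: "nat \<Rightarrow> nat list \<Rightarrow> nat list \<Rightarrow> bool" for n where
  gen1: "\<lbrakk>{a, b, c, d} \<subseteq> {1..n}; u \<in> lists {1..n}; v \<in> lists {1..n}; a \<le> b; b < c; c \<le> d\<rbrakk> \<Longrightarrow>
    baxt_gen n ([c] @ u @ [a, d] @ v @ [b]) ([c] @ u @ [d, a] @ v @ [b])"
| gen2: "\<lbrakk>{a, b, c, d} \<subseteq> {1..n}; u \<in> lists {1..n}; v \<in> lists {1..n}; a < b; b \<le> c; c < d\<rbrakk> \<Longrightarrow>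
    baxt_gen n ([b] @ u @ [d, a] @ v @ [c]) ([b] @ u @ [a, d] @ v @ [c])"

inductive_set baxt_cong :: "nat \<Rightarrow> (nat list \<times> nat list) set" for n where
  gen: "baxt_gen n u v \<Longrightarrow> (u, v) \<in> baxt_cong n"
| refl: "u \<in> lists {1..n} \<Longrightarrow> (u, u) \<in> baxt_cong n"
| sym: "(u, v) \<in> baxt_cong n \<Longrightarrow> (v, u) \<in> baxt_cong n"
| trans: "(u, v) \<in> baxt_cong n \<Longrightarrow> (v, w) \<in> baxt_cong n \<Longrightarrow> (u, w) \<in> baxt_cong n"
| mult: "(u, u') \<in> baxt_cong n \<Longrightarrow> (v, v') \<in> baxt_cong n \<Longrightarrow> (u @ v, u' @ v') \<in> baxt_cong n"

definition baxt :: "nat \<Rightarrow> nat list set monoid" where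
  "baxt n = \<lparr>carrier = lists {1..n} // baxt_cong n,
     mult = (\<lambda>A B. \<Union>u\<in>A. \<Union>v\<in>B. baxt_cong n `` {u @ v}),
     one = baxt_cong n `` {[]}\<rparr>"

definition sharp_word :: "nat \<Rightarrow> nat list \<Rightarrow> nat list" where
  "sharp_word n w = rev (map (\<lambda>i. n + 1 - i) w)"

definition baxt_sharp :: "nat \<Rightarrow> nat list set \<Rightarrow> nat list set" where
  "baxt_sharp n A = (\<Union>u\<in>A. baxt_cong n `` {sharp_word n u})"

lemma baxt_gen_lists: "baxt_gen n u v \<Longrightarrow> u \<in> lists {1..n} \<and> v \<in> lists {1..n}"
  by (induction rule: baxt_gen.induct) auto

lemma baxt_cong_lists: "(u, v) \<in> baxt_cong n \<Longrightarrow> u \<in> lists {1..n} \<and> v \<in> lists {1..n}"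
  by (induction rule: baxt_cong.induct) (auto dest: baxt_gen_lists)

lemma equiv_baxt_cong: "equiv (lists {1..n}) (baxt_cong n)"
proof (rule equivI)
  show "baxt_cong n \<subseteq> lists {1..n} \<times> lists {1..n}"
    by (auto dest: baxt_cong_lists)
  show "refl_on (lists {1..n}) (baxt_cong n)"
    by (rule refl_onI) (rule baxt_cong.refl)
  show "sym (baxt_cong n)"
    by (rule symI) (rule baxt_cong.sym)
  show "trans (baxt_cong n)"
    by (rule transI) (rule baxt_cong.trans)
qed

lemma sharp_word_lists: "u \<in> lists {1..n} \<Longrightarrow> sharp_word n u \<in> lists {1..n}"
  by (force simp: sharp_word_def)

lemma sharp_word_append: "sharp_word n (u @ v) = sharp_word n v @ sharp_word n u"
  by (simp add: sharp_word_def)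

lemma sharp_word_sharp_word: "u \<in> lists {1..n} \<Longrightarrow> sharp_word n (sharp_word n u) = u"
  by (induction u) (auto simp: sharp_word_def)

lemma sharp_word_gen:
  assumes "baxt_gen n u v"
  shows "(sharp_word n u, sharp_word n v) \<in> baxt_cong n"
  using assms
proof cases
  case (gen1 a b c d u' v')
  have "baxt_gen n ([n + 1 - b] @ sharp_word n v' @ [n + 1 - d, n + 1 - a] @ sharp_word n u' @ [n + 1 - c])
          ([n + 1 - b] @ sharp_word n v' @ [n + 1 - a, n + 1 - d] @ sharp_word n u' @ [n + 1 - c])"
    by (rule baxt_gen.gen1) (use gen1 in \<open>force simp: sharp_word_def\<close>)+
  then show ?thesis
    using gen1 by (simp add: sharp_word_def) (metis baxt_cong.gen)
next
  case (gen2 a b c d u' v')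
  have "baxt_gen n ([n + 1 - c] @ sharp_word n v' @ [n + 1 - a, n + 1 - d] @ sharp_word n u' @ [n + 1 - b])
          ([n + 1 - c] @ sharp_word n v' @ [n + 1 - d, n + 1 - a] @ sharp_word n u' @ [n + 1 - b])"
    by (rule baxt_gen.gen2) (use gen2 in \<open>force simp: sharp_word_def\<close>)+
  then show ?thesis
    using gen2 by (simp add: sharp_word_def) (metis baxt_cong.gen)
qed

lemma sharp_word_cong:
  "(u, v) \<in> baxt_cong n \<Longrightarrow> (sharp_word n u, sharp_word n v) \<in> baxt_cong n"
proof (induction rule: baxt_cong.induct)
  case (mult u u' v v')
  then show ?case
    unfolding sharp_word_append by (intro baxt_cong.mult)
next
  case (trans u v w)
  from trans.IH show ?case by (rule baxt_cong.trans)
qed (auto intro: sharp_word_gen baxt_cong.sym baxt_cong.refl[OF sharp_word_lists]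
    simp del: in_lists_conv_set One_nat_def)

lemma baxt_mult_class:
  assumes "u \<in> lists {1..n}" "v \<in> lists {1..n}"
  shows "baxt_cong n `` {u} \<otimes>\<^bsub>baxt n\<^esub> baxt_cong n `` {v} = baxt_cong n `` {u @ v}"
proof -
  have "congruent2 (baxt_cong n) (baxt_cong n) (\<lambda>u v. baxt_cong n `` {u @ v})"
    by (rule congruent2I')
      (auto intro!: equiv_class_eq[OF equiv_baxt_cong] intro: baxt_cong.mult)
  then show ?thesis
    using UN_equiv_class2[OF equiv_baxt_cong equiv_baxt_cong _ assms] by (simp add: baxt_def)
qed

lemma baxt_sharp_class:
  assumes "u \<in> lists {1..n}"
  shows "baxt_sharp n (baxt_cong n `` {u}) = baxt_cong n `` {sharp_word n u}"
proof -
  have "congruent (baxt_cong n) (\<lambda>u. baxt_cong n `` {sharp_word n u})"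
    by (auto simp: congruent_def intro!: equiv_class_eq[OF equiv_baxt_cong] sharp_word_cong)
  then show ?thesis
    using UN_equiv_class[OF equiv_baxt_cong _ assms] by (simp add: baxt_sharp_def)
qed

lemma baxt_carrierE:
  assumes "A \<in> carrier (baxt n)"
  obtains u where "u \<in> lists {1..n}" "A = baxt_cong n `` {u}"
  using assms that by (auto simp: baxt_def elim!: quotientE simp del: in_lists_conv_set One_nat_def)

lemma baxt_carrierI: "u \<in> lists {1..n} \<Longrightarrow> baxt_cong n `` {u} \<in> carrier (baxt n)"
  by (simp add: baxt_def quotientI del: in_lists_conv_set One_nat_def)

lemma baxt_one: "\<one>\<^bsub>baxt n\<^esub> = baxt_cong n `` {[]}"
  by (simp add: baxt_def)

lemma involution_monoid_baxt: "involution_monoid (baxt n) (baxt_sharp n)"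
proof
  fix A B assume "A \<in> carrier (baxt n)" "B \<in> carrier (baxt n)"
  then obtain u v where "u \<in> lists {1..n}" "A = baxt_cong n `` {u}"
      "v \<in> lists {1..n}" "B = baxt_cong n `` {v}"
    by (elim baxt_carrierE)
  then show "A \<otimes>\<^bsub>baxt n\<^esub> B \<in> carrier (baxt n)"
    and "baxt_sharp n (A \<otimes>\<^bsub>baxt n\<^esub> B) = baxt_sharp n B \<otimes>\<^bsub>baxt n\<^esub> baxt_sharp n A"
    by (simp_all add: baxt_mult_class baxt_sharp_class sharp_word_lists sharp_word_append
        baxt_carrierI append_in_lists_conv del: in_lists_conv_set One_nat_def)
next
  fix A B C assume "A \<in> carrier (baxt n)" "B \<in> carrier (baxt n)" "C \<in> carrier (baxt n)"
  then obtain u v w where "u \<in> lists {1..n}" "A = baxt_cong n `` {u}"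
      "v \<in> lists {1..n}" "B = baxt_cong n `` {v}"
      "w \<in> lists {1..n}" "C = baxt_cong n `` {w}"
    by (elim baxt_carrierE)
  then show "A \<otimes>\<^bsub>baxt n\<^esub> B \<otimes>\<^bsub>baxt n\<^esub> C = A \<otimes>\<^bsub>baxt n\<^esub> (B \<otimes>\<^bsub>baxt n\<^esub> C)"
    by (simp add: baxt_mult_class append_in_lists_conv del: in_lists_conv_set One_nat_def)
next
  show "\<one>\<^bsub>baxt n\<^esub> \<in> carrier (baxt n)"
    by (simp add: baxt_one baxt_carrierI)
next
  fix A assume "A \<in> carrier (baxt n)"
  then obtain u where "u \<in> lists {1..n}" "A = baxt_cong n `` {u}"
    by (elim baxt_carrierE)
  then show "\<one>\<^bsub>baxt n\<^esub> \<otimes>\<^bsub>baxt n\<^esub> A = A" "A \<otimes>\<^bsub>baxt n\<^esub> \<one>\<^bsub>baxt n\<^esub> = A"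
      "baxt_sharp n A \<in> carrier (baxt n)" "baxt_sharp n (baxt_sharp n A) = A"
    by (simp_all add: baxt_one baxt_mult_class baxt_sharp_class sharp_word_lists
        sharp_word_sharp_word baxt_carrierI lists.Nil del: in_lists_conv_set One_nat_def)
qed

section \<open>Words over variables and word identities\<close>

datatype 'x var = Plain 'x | Starred 'x

fun star :: "'x var \<Rightarrow> 'x var" where
  "star (Plain x) = Starred x"
| "star (Starred x) = Plain x"

text \<open>A word is a list of variables; \<open>con u\<close> is \<^term>\<open>set u\<close> and \<open>occ x u\<close> is
  \<^term>\<open>count_list u x\<close>.\<close>

fun var_value :: "('m \<Rightarrow> 'm) \<Rightarrow> ('x \<Rightarrow> 'm) \<Rightarrow> 'x var \<Rightarrow> 'm" where
  "var_value inv_op \<phi> (Plain x) = \<phi> x"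
| "var_value inv_op \<phi> (Starred x) = inv_op (\<phi> x)"

definition word_value :: "('m, 'b) monoid_scheme \<Rightarrow> ('m \<Rightarrow> 'm) \<Rightarrow> ('x \<Rightarrow> 'm) \<Rightarrow> 'x var list \<Rightarrow> 'm" where
  "word_value M inv_op \<phi> w = foldr (\<lambda>z m. var_value inv_op \<phi> z \<otimes>\<^bsub>M\<^esub> m) w \<one>\<^bsub>M\<^esub>"

definition identity_holds ::
  "('m, 'b) monoid_scheme \<Rightarrow> ('m \<Rightarrow> 'm) \<Rightarrow> 'x var list \<Rightarrow> 'x var list \<Rightarrow> bool" where
  "identity_holds M inv_op u v \<longleftrightarrow>
    (\<forall>\<phi> \<in> UNIV \<rightarrow> carrier M. word_value M inv_op \<phi> u = word_value M inv_op \<phi> v)"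

definition balanced :: "'x var list \<Rightarrow> 'x var list \<Rightarrow> bool" where
  "balanced u v \<longleftrightarrow> (\<forall>x \<in> set (u @ v). count_list u x = count_list v x)"

definition permutation_of :: "'x var list \<Rightarrow> 'x var list \<Rightarrow> bool" where
  "permutation_of a' a \<longleftrightarrow> (\<forall>z. count_list a z = count_list a' z)"

definition pair_vars :: "'x var \<Rightarrow> 'x var \<Rightarrow> 'x var set" where
  "pair_vars x y = {x, star x, y, star y}"

definition restrict_word :: "'x var list \<Rightarrow> 'x var \<Rightarrow> 'x var \<Rightarrow> 'x var list" where
  "restrict_word u x y = filter (\<lambda>z. z \<in> pair_vars x y) u"

definition with_prefix :: "'x var list \<Rightarrow> 'x var set \<Rightarrow> 'x var list set" where
  "with_prefix p Z = {p @ w | w. w \<in> lists Z}"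

definition with_suffix :: "'x var set \<Rightarrow> 'x var list \<Rightarrow> 'x var list set" where
  "with_suffix Z s = {w @ s | w. w \<in> lists Z}"

section \<open>The conditions on a pair of variables\<close>

definition cond_I :: "'x var list \<Rightarrow> 'x var list \<Rightarrow> 'x var \<Rightarrow> 'x var \<Rightarrow> bool" where
  "cond_I u v x y \<longleftrightarrow>
    (\<forall>\<alpha>\<ge>1. restrict_word u x y \<in> with_prefix (replicate \<alpha> x @ [star x]) (pair_vars x y) \<longrightarrow>
           restrict_word v x y \<in> with_prefix (replicate \<alpha> x @ [star x]) (pair_vars x y)) \<and>
    (\<forall>\<alpha>\<ge>1. restrict_word u x y \<in> with_suffix (pair_vars x y) ([star x] @ replicate \<alpha> x) \<longrightarrow>
           restrict_word v x y \<in> with_suffix (pair_vars x y) ([star x] @ replicate \<alpha> x))"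

definition cond_II :: "'x var list \<Rightarrow> 'x var list \<Rightarrow> 'x var \<Rightarrow> 'x var \<Rightarrow> bool" where
  "cond_II u v x y \<longleftrightarrow>
    (\<forall>\<alpha>\<ge>1. restrict_word u x y \<in> with_prefix (replicate \<alpha> y @ [x]) (pair_vars x y) \<longrightarrow>
           restrict_word v x y \<in> with_prefix (replicate \<alpha> y @ [x]) (pair_vars x y)) \<and>
    (\<forall>\<alpha>\<ge>1. restrict_word u x y \<in> with_suffix (pair_vars x y) ([x] @ replicate \<alpha> y) \<longrightarrow>
           restrict_word v x y \<in> with_suffix (pair_vars x y) ([x] @ replicate \<alpha> y))"

definition cond_III :: "'x var list \<Rightarrow> 'x var list \<Rightarrow> 'x var \<Rightarrow> 'x var \<Rightarrow> bool" where
  "cond_III u v x y \<longleftrightarrow>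
    (\<forall>a. set a = {star x, star y} \<and>
         restrict_word u x y \<in> with_prefix (a @ [x]) (pair_vars x y) \<longrightarrow>
       (\<exists>a'. permutation_of a' a \<and>
         (restrict_word v x y \<in> with_prefix (a' @ [x]) (pair_vars x y) \<or>
          restrict_word v x y \<in> with_prefix (a' @ [y]) (pair_vars x y)))) \<and>
    (\<forall>a. set a = {star x, star y} \<and>
         restrict_word u x y \<in> with_suffix (pair_vars x y) ([x] @ a) \<longrightarrow>
       (\<exists>a'. permutation_of a' a \<and>
         (restrict_word v x y \<in> with_suffix (pair_vars x y) ([x] @ a') \<or>
          restrict_word v x y \<in> with_suffix (pair_vars x y) ([y] @ a'))))"

text \<open>Pitfall: these conditions are to be imposed for all \<open>x\<close> occurring in \<open>u\<close> and all variables \<open>y\<close>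
  other than \<open>x\<close> and \<open>star x\<close>, so that \<open>y\<close>, or both \<open>y\<close> and \<open>star y\<close>, may be absent from \<open>u\<close>.
  Requiring \<open>y\<close> to occur in \<open>u\<close> as well would be too weak for the characterization of the
  identities of \<open>baxt 2\<close>: the pair \<open>x x\<^sup>*\<close>, \<open>x\<^sup>* x\<close> would satisfy all conditions vacuously, but
  \<open>x \<mapsto> 1\<close> gives the inequivalent words \<open>12\<close> and \<open>21\<close>. Another such pair, with \<open>y\<close> absent
  and \<open>y\<^sup>*\<close> present, is \<open>x\<^sup>*y\<^sup>*xy\<^sup>*x\<^sup>*y\<^sup>*x\<close>, \<open>x\<^sup>*y\<^sup>*y\<^sup>*xx\<^sup>*y\<^sup>*x\<close>, which
  \<open>x, y \<mapsto> 2\<close> separates.\<close>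

end

(*
  Let lead w be the number of letters of w before the first 2. In rank two the only relations are
  2 u 1 2 v 1 = 2 u 2 1 v 1, so everything between the first 2 and the last 1 commutes and a
  word w over {1, 2} is determined up to congruence by its content, by lead w, and by
  lead (w#), the number of 2s after the last 1. The involution turns the second number for an
  evaluation of u into the first one for an evaluation of the reversed word, so it is enough to
  match "lead of every evaluation agrees" with the left halves (a) of the conditions.

  For an evaluation f let T be the set of variables whose value contains a 2, and write
  u = p t q with t the first variable of T in u. Then lead (f u) = |f p| + lead (f t), where
  lead (f t) = 0 if the value of t* has no 1, that is if t* is not in T. Conditions (I)(a) and (II)(a)
  say that for every pair s, y the words u[s, y] and v[s, y] agree up to and including the first
  letter different from s; with (III)(a) they also give that the longest prefixes of u[x, y] and
  v[x, y] over {x, y} have the same content. If t* is in T, comparing u[z, t] with v[z, t] shows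
  that t is also the first variable of T in v and that all relevant counts agree. If t* is not in
  T, the prefixes over {t*, z} bound the count of z before the first variable of T in v by that
  in u, and symmetry gives equality.
*)

theory Submission
  imports Defs "HOL-Library.Multiset"
begin

section \<open>The Baxter congruence of rank two\<close>

declare in_lists_conv_set [simp del] One_nat_def [simp del]

text \<open>For a word without 2 the value is its full length; this default makes
  \<open>lead\<close> additive behind a prefix free of 2s.\<close>

definition lead :: "nat list \<Rightarrow> nat" where
  "lead w = length (takeWhile (\<lambda>i. i \<noteq> 2) w)"

lemma lead_append: "lead (u @ v) = (if 2 \<in> set u then lead u else length u + lead v)"
  unfolding lead_def by (auto simp: takeWhile_append takeWhile_eq_all_conv[THEN iffD2])

lemma lead_eq_length: "2 \<notin> set u \<Longrightarrow> lead u = length u"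
  using lead_append[of u "[]"] by (simp add: lead_def)

lemma sharp_word_Nil [simp]: "sharp_word n [] = []"
  by (simp add: sharp_word_def)

lemma length_sharp_word [simp]: "length (sharp_word n u) = length u"
  by (simp add: sharp_word_def)

lemma set_sharp_word: "set (sharp_word n u) = (\<lambda>i. n + 1 - i) ` set u"
  by (simp add: sharp_word_def)

lemma lists_le_2_iff: "u \<in> lists {1..2} \<longleftrightarrow> set u \<subseteq> {1, 2 :: nat}"
  by (auto simp: in_lists_conv_set)

text \<open>In rank two \<open>gen1\<close> forces a = b = 1 and c = d = 2, while
  \<open>gen2\<close> would need three letters. The swapped pair thus lies behind a 2 and before a
  1, where it affects neither lead. In a product, \<open>lead\<close> depends only on the leads and
  lengths of the factors and on whether the first contains a 2; content fixes the last two.\<close>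

lemma baxt_cong_2_invariants:
  assumes "(u, v) \<in> baxt_cong 2"
  shows "mset u = mset v \<and> lead u = lead v \<and> lead (sharp_word 2 u) = lead (sharp_word 2 v)"
  using assms
proof induction
  case (gen u v)
  then show ?case
  proof cases
    case (gen1 a b c d u' v')
    then have "b = 1" "c = 2" by auto
    then show ?thesis
      using gen1 by (simp add: lead_def sharp_word_def)
  next
    case (gen2 a b c d u' v')
    then show ?thesis by auto
  qed
next
  case (mult u u' v v')
  then have m: "mset u = mset u'" "mset v = mset v'" by auto
  have "set u = set u'" "length u = length u'" "length v = length v'"
    using m by (auto dest: mset_eq_setD mset_eq_length)
  moreover have "set (sharp_word 2 v) = set (sharp_word 2 v')"
    using m by (auto simp: set_sharp_word dest: mset_eq_setD)
  ultimately show ?case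
    using mult.IH by (simp add: lead_append sharp_word_append)
qed auto

section \<open>Sorting between the first 2 and the last 1\<close>

lemma baxt_cong_append_lr:
  assumes "(u, v) \<in> baxt_cong n" "a \<in> lists {1..n}" "b \<in> lists {1..n}"
  shows "(a @ u @ b, a @ v @ b) \<in> baxt_cong n"
  by (intro baxt_cong.mult baxt_cong.refl assms)

lemma baxt_cong_2_swap:
  assumes "u \<in> lists {1..2}" "v \<in> lists {1..2}"
  shows "([2] @ u @ [2, 1] @ v @ [1], [2] @ u @ [1, 2] @ v @ [1]) \<in> baxt_cong 2"
  by (rule baxt_cong.sym, rule baxt_cong.gen, rule baxt_gen.gen1) (use assms in auto)

text \<open>Each swap moves the 2 past one 1; that 1 is then absorbed into \<open>u\<close>, which
  is why the induction keeps \<open>u\<close> arbitrary.\<close>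

lemma baxt_cong_2_shift:
  assumes "u \<in> lists {1..2}" "v \<in> lists {1..2}"
  shows "([2] @ u @ [2] @ replicate k 1 @ v @ [1], [2] @ u @ replicate k 1 @ [2] @ v @ [1]) \<in> baxt_cong 2"
  using assms
proof (induction k arbitrary: u)
  case 0
  then show ?case
    by (simp add: baxt_cong.refl lists_le_2_iff)
next
  case (Suc k)
  have "([2] @ u @ [2, 1] @ (replicate k 1 @ v) @ [1], [2] @ u @ [1, 2] @ (replicate k 1 @ v) @ [1]) \<in> baxt_cong 2"
    using Suc.prems by (intro baxt_cong_2_swap) (auto simp: lists_le_2_iff)
  moreover have "([2] @ (u @ [1]) @ [2] @ replicate k 1 @ v @ [1],
      [2] @ (u @ [1]) @ replicate k 1 @ [2] @ v @ [1]) \<in> baxt_cong 2"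
    using Suc.prems by (intro Suc.IH) (auto simp: lists_le_2_iff)
  ultimately show ?case
    using baxt_cong.trans by fastforce
qed

text \<open>Insertion sort: the tail is sorted with the first letter moved into \<open>u\<close>. A
  first letter 1 is then in place, and a first letter 2 is shifted past the block of 1s.\<close>

lemma baxt_cong_2_sort:
  assumes "u \<in> lists {1..2}" "m \<in> lists {1..2}"
  shows "([2] @ u @ m @ [1],
    [2] @ u @ replicate (count_list m 1) 1 @ replicate (count_list m 2) 2 @ [1]) \<in> baxt_cong 2"
  using assms
proof (induction m arbitrary: u)
  case Nil
  then show ?case
    by (simp add: baxt_cong.refl lists_le_2_iff)
next
  case (Cons a m)
  have sort: "([2] @ (u @ [a]) @ m @ [1],
    [2] @ (u @ [a]) @ replicate (count_list m 1) 1 @ replicate (count_list m 2) 2 @ [1]) \<in> baxt_cong 2"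
    using Cons.prems by (intro Cons.IH) auto
  consider "a = 1" | "a = 2"
    using Cons.prems by fastforce
  then have merge: "([2] @ (u @ [a]) @ replicate (count_list m 1) 1 @ replicate (count_list m 2) 2 @ [1],
      [2] @ u @ replicate (count_list (a # m) 1) 1 @ replicate (count_list (a # m) 2) 2 @ [1]) \<in> baxt_cong 2"
  proof cases
    case 1
    then show ?thesis
      using Cons.prems by (simp add: baxt_cong.refl lists_le_2_iff set_replicate_conv_if flip: Suc_eq_plus1)
  next
    case 2
    then show ?thesis
      using Cons.prems baxt_cong_2_shift[of u "replicate (count_list m 2) 2" "count_list m 1"]
      by (simp add: lists_le_2_iff set_replicate_conv_if flip: Suc_eq_plus1 split: if_splits)
  qed
  from baxt_cong.trans[OF sort merge] show ?case by simp
qed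

lemma baxt_cong_2_inner:
  assumes "m \<in> lists {1..2}" "m' \<in> lists {1..2}" "mset m = mset m'"
  shows "([2] @ m @ [1], [2] @ m' @ [1]) \<in> baxt_cong 2"
proof -
  have "count_list m i = count_list m' i" for i
    using assms(3) by (metis count_mset)
  then show ?thesis
    using baxt_cong_2_sort[of "[]" m] baxt_cong_2_sort[of "[]" m'] assms(1,2)
    by simp (blast intro: baxt_cong.sym baxt_cong.trans)
qed

section \<open>Normal forms of words over {1, 2}\<close>

lemma replicate_split:
  obtains k r where "w = replicate k s @ r" "r = [] \<or> hd r \<noteq> s"
proof
  let ?a = "takeWhile (\<lambda>i. i = s) w"
  have "?a = replicate (length ?a) s"
    by (intro replicate_eqI) (auto dest: set_takeWhileD)
  then show "w = replicate (length ?a) s @ dropWhile (\<lambda>i. i = s) w"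
    by (metis takeWhile_dropWhile_id)
  show "dropWhile (\<lambda>i. i = s) w = [] \<or> hd (dropWhile (\<lambda>i. i = s) w) \<noteq> s"
    using hd_dropWhile[of "\<lambda>i. i = s" w] by blast
qed

text \<open>Strip the maximal block of 1s on the left, then that of 2s on the right: the rest is
  empty or starts with 2 and ends with 1.\<close>

lemma word_12_cases [consumes 1, case_names sorted descent]:
  assumes "w \<in> lists {1..2 :: nat}"
  obtains (sorted) p q where "w = replicate p 1 @ replicate q 2"
  | (descent) p m q where "w = replicate p 1 @ [2] @ m @ [1] @ replicate q 2" "m \<in> lists {1..2}"
proof -
  have w: "set w \<subseteq> {1, 2}" using assms by (simp only: lists_le_2_iff)
  obtain p r where r: "w = replicate p 1 @ r" "r = [] \<or> hd r \<noteq> 1"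
    using replicate_split .
  obtain q c where c: "rev r = replicate q 2 @ c" "c = [] \<or> hd c \<noteq> 2"
    using replicate_split .
  then have r': "r = rev c @ replicate q 2"
    by (metis rev_append rev_replicate rev_rev_ident)
  show ?thesis
  proof (cases c)
    case Nil
    with r r' show ?thesis by (intro sorted[of p q]) simp
  next
    case (Cons i c')
    with c(2) r r' w have "i = 1" by auto
    have "rev c' \<noteq> []"
      using r(2) r' Cons \<open>i = 1\<close> by auto
    then obtain j m where m: "rev c' = j # m" by (cases "rev c'") auto
    then have "j = 2"
      using r r' Cons w by auto
    then show ?thesis
      using r r' Cons m w \<open>i = 1\<close> by (intro descent[of p m q]) (simp_all add: lists_le_2_iff)
  qed
qed

lemma lead_replicate_1 [simp]: "lead (replicate p 1 @ w) = p + lead w"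
  by (simp add: lead_append)

lemma lead_Cons [simp]: "lead (2 # w) = 0" "lead [] = 0" "lead (1 # w) = Suc (lead w)"
  by (simp_all add: lead_def)

lemma lead_replicate_2 [simp]: "lead (replicate q 2) = 0"
  by (cases q) auto

text \<open>A sorted word has \<open>lead\<close> equal to its number of 1s, a word with a descent
  has a smaller one, so the two forms do not mix. Two sorted words of equal content coincide. For
  two descents the leads are the outer exponents, and the middle parts have equal content, hence are
  congruent between 2 and 1.\<close>

lemma baxt_cong_2_iff:
  assumes u: "u \<in> lists {1..2}" and v: "v \<in> lists {1..2}"
  shows "(u, v) \<in> baxt_cong 2 \<longleftrightarrow>
    mset u = mset v \<and> lead u = lead v \<and> lead (sharp_word 2 u) = lead (sharp_word 2 v)"
    (is "_ \<longleftrightarrow> ?R")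
proof
  assume "(u, v) \<in> baxt_cong 2"
  then show ?R by (rule baxt_cong_2_invariants)
next
  assume R: ?R
  then have count: "count_list u i = count_list v i" for i
    by (metis count_mset)
  have lead_sharp: "lead (sharp_word 2 (replicate p 1 @ [2] @ m @ [1] @ replicate q 2)) = q" for p m q
    by (simp add: sharp_word_def lead_append One_nat_def)
  have rep: "count_list (replicate k x) y = (if x = y then k else 0)" for k and x y :: nat
    by (induction k) auto
  from u show "(u, v) \<in> baxt_cong 2"
  proof (cases rule: word_12_cases)
    case s: (sorted p q)
    from v show ?thesis
    proof (cases rule: word_12_cases)
      case (sorted p' q')
      with s count[of 1] count[of 2] have "u = v" by (simp add: rep)
      then show ?thesis using u by (simp add: baxt_cong.refl)
    next
      case (descent p' m' q')
      with s R count[of 1] show ?thesis by (simp add: rep)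
    qed
  next
    case d: (descent p m q)
    from v show ?thesis
    proof (cases rule: word_12_cases)
      case (sorted p' q')
      with d R count[of 1] show ?thesis by (simp add: rep)
    next
      case (descent p' m' q')
      have "p = p'" "q = q'"
        using R unfolding d(1) descent(1) lead_sharp by simp_all
      moreover from this have "mset m = mset m'"
        using d descent R by simp
      ultimately show ?thesis
        using baxt_cong_append_lr[OF baxt_cong_2_inner[OF d(2) descent(2)],
            of "replicate p 1" "replicate q 2"] d(1) descent(1)
        by (simp add: lists_le_2_iff set_replicate_conv_if)
    qed
  qed
qed

section \<open>Evaluations of words in the free monoid\<close>

lemma star_star [simp]: "star (star x) = x"
  by (cases x) auto

lemma star_neq [simp]: "star x \<noteq> x" "x \<noteq> star x"
  by (cases x; simp)+

lemma star_eq_star [simp]: "star x = star y \<longleftrightarrow> x = y"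
  by (metis star_star)

lemma star_eq_swap: "star x = y \<longleftrightarrow> x = star y"
  by auto

text \<open>A substitution into the monoid is replaced by a choice of representing words, so that
  letters can be counted. Prescribing \<open>f\<close> on starred variables too makes
  \<open>f \<circ> star\<close> an evaluation again.\<close>

definition evaluation :: "('x var \<Rightarrow> nat list) \<Rightarrow> bool" where
  "evaluation f \<longleftrightarrow> (\<forall>z. f z \<in> lists {1..2} \<and> f (star z) = sharp_word 2 (f z))"

lemma evaluation_concat: "evaluation f \<Longrightarrow> concat (map f u) \<in> lists {1..2}"
  by (induction u) (auto simp: evaluation_def append_in_lists_conv)

lemma evaluation_star: "evaluation f \<Longrightarrow> evaluation (f \<circ> star)"
  unfolding evaluation_def by (metis comp_apply)

lemma sharp_word_concat:
  "evaluation f \<Longrightarrow> sharp_word 2 (concat (map f u)) = concat (map (f \<circ> star) (rev u))"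
  by (induction u) (auto simp: evaluation_def sharp_word_append)

lemma word_value_baxt:
  fixes f :: "'x var \<Rightarrow> nat list"
  assumes f: "evaluation f"
  shows "word_value (baxt 2) (baxt_sharp 2) (\<lambda>x. baxt_cong 2 `` {f (Plain x)}) u
    = baxt_cong 2 `` {concat (map f u)}"
proof (induction u)
  case Nil
  show ?case by (simp add: word_value_def baxt_one)
next
  case (Cons z u)
  have f': "f z \<in> lists {1..2}" for z
    using f unfolding evaluation_def by blast
  have "var_value (baxt_sharp 2) (\<lambda>x. baxt_cong 2 `` {f (Plain x)}) z = baxt_cong 2 `` {f z}"
  proof (cases z)
    case (Starred x)
    have "f (star (Plain x)) = sharp_word 2 (f (Plain x))"
      using f unfolding evaluation_def by blast
    then show ?thesis
      using Starred by (simp add: baxt_sharp_class[OF f'])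
  qed simp
  then show ?case
    using Cons.IH by (simp add: word_value_def baxt_mult_class[OF f' evaluation_concat[OF f]])
qed

lemma identity_holds_iff:
  fixes u v :: "'x var list"
  shows "identity_holds (baxt 2) (baxt_sharp 2) u v \<longleftrightarrow>
    (\<forall>f. evaluation f \<longrightarrow> (concat (map f u), concat (map f v)) \<in> baxt_cong 2)"
    (is "?L \<longleftrightarrow> ?R")
proof
  assume ?L
  show ?R
  proof (intro allI impI)
    fix f :: "'x var \<Rightarrow> nat list" assume f: "evaluation f"
    have "(\<lambda>x. baxt_cong 2 `` {f (Plain x)}) \<in> UNIV \<rightarrow> carrier (baxt 2)"
      using f by (auto intro!: baxt_carrierI simp: evaluation_def)
    with \<open>?L\<close> have "baxt_cong 2 `` {concat (map f u)} = baxt_cong 2 `` {concat (map f v)}"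
      unfolding identity_holds_def word_value_baxt[OF f, symmetric] by blast
    then show "(concat (map f u), concat (map f v)) \<in> baxt_cong 2"
      using eq_equiv_class[OF _ equiv_baxt_cong evaluation_concat[OF f]] by blast
  qed
next
  assume R: ?R
  show ?L
    unfolding identity_holds_def
  proof
    fix \<phi> :: "'x \<Rightarrow> nat list set" assume "\<phi> \<in> UNIV \<rightarrow> carrier (baxt 2)"
    then have "\<forall>x. \<exists>w. w \<in> lists {1..2} \<and> \<phi> x = baxt_cong 2 `` {w}"
      by (metis Pi_mem UNIV_I baxt_carrierE)
    then obtain g where g: "\<And>x. g x \<in> lists {1..2}" "\<And>x. \<phi> x = baxt_cong 2 `` {g x}"
      by metis
    define f where "f z = (case z of Plain x \<Rightarrow> g x | Starred x \<Rightarrow> sharp_word 2 (g x))" for z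
    have f: "evaluation f"
      unfolding evaluation_def f_def
      using g(1) sharp_word_lists[OF g(1)] sharp_word_sharp_word[OF g(1)]
      by (auto split: var.splits elim!: star.elims)
    have "\<phi> = (\<lambda>x. baxt_cong 2 `` {f (Plain x)})"
      by (simp add: g(2) f_def fun_eq_iff)
    then show "word_value (baxt 2) (baxt_sharp 2) \<phi> u = word_value (baxt 2) (baxt_sharp 2) \<phi> v"
      using R f by (simp add: word_value_baxt[OF f] equiv_class_eq[OF equiv_baxt_cong])
  qed
qed

lemma mset_concat_map_cong:
  assumes "mset u = mset v"
  shows "mset (concat (map f u)) = mset (concat (map f v))"
proof -
  have "mset (concat (map f w)) = (\<Sum>z\<in>#mset w. mset (f z))" for w
    by (induction w) auto
  then show ?thesis using assms by simp
qed

section \<open>Reduction to content and leads\<close>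

definition lead_agree :: "'x var list \<Rightarrow> 'x var list \<Rightarrow> bool" where
  "lead_agree u v \<longleftrightarrow>
    (\<forall>f. evaluation f \<longrightarrow> lead (concat (map f u)) = lead (concat (map f v)))"

text \<open>Test evaluations that erase all variables outside the pair, so that only the restricted
  word matters.\<close>

fun pair_eval :: "'x var \<Rightarrow> nat list \<Rightarrow> 'x var \<Rightarrow> nat list \<Rightarrow> 'x var \<Rightarrow> nat list" where
  "pair_eval x a y b z = (if z = x then a else if z = star x then sharp_word 2 a
     else if z = y then b else if z = star y then sharp_word 2 b else [])"

declare pair_eval.simps [simp del]

text \<open>Closing \<open>A\<close> under \<open>star\<close> keeps it finite, so some letter of
  the infinite alphabet avoids it. Such a fresh variable is a neutral partner when a condition on
  pairs is to speak about one variable.\<close>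

lemma ex_fresh_var:
  fixes A :: "'x :: infinite var set"
  assumes "finite A"
  shows "\<exists>y. y \<notin> A \<and> star y \<notin> A"
proof -
  have "finite (Plain -` (A \<union> star ` A))"
    using assms by (intro finite_vimageI) (auto simp: inj_def)
  then obtain x where "x \<notin> Plain -` (A \<union> star ` A)"
    using ex_new_if_finite[OF infinite_UNIV] by blast
  then have "Plain x \<notin> A" "star (Plain x) \<notin> A"
    by (auto simp del: star.simps) (metis image_eqI star_star)
  then show ?thesis by blast
qed

lemma evaluation_pair_eval:
  assumes "a \<in> lists {1..2}" "b \<in> lists {1..2}" "y \<noteq> x" "star x \<noteq> y"
  shows "evaluation (pair_eval x a y b)"
  unfolding evaluation_def
  using assms(3,4) assms(1,2)[THEN sharp_word_lists] assms(1,2)[THEN sharp_word_sharp_word] assms(1,2)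
  by (auto simp: pair_eval.simps star_eq_swap)

lemma identity_holds_iff_lead_agree:
  fixes u v :: "'x :: infinite var list"
  shows "identity_holds (baxt 2) (baxt_sharp 2) u v \<longleftrightarrow>
    mset u = mset v \<and> lead_agree u v \<and> lead_agree (rev u) (rev v)"
proof -
  have "identity_holds (baxt 2) (baxt_sharp 2) u v \<longleftrightarrow>
    (\<forall>f. evaluation f \<longrightarrow> mset (concat (map f u)) = mset (concat (map f v))) \<and>
    lead_agree u v \<and>
    (\<forall>f. evaluation f \<longrightarrow> lead (concat (map (f \<circ> star) (rev u))) = lead (concat (map (f \<circ> star) (rev v))))"
    unfolding identity_holds_iff lead_agree_def
    by (simp add: baxt_cong_2_iff[OF evaluation_concat evaluation_concat] sharp_word_concat) blast
  also have "(\<forall>f. evaluation f \<longrightarrow> lead (concat (map (f \<circ> star) (rev u))) = lead (concat (map (f \<circ> star) (rev v))))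
     \<longleftrightarrow> lead_agree (rev u) (rev v)"
  proof -
    \<comment> \<open>As \<open>f\<close> runs over all evaluations, so does
      \<open>f \<circ> star\<close>.\<close>
    have "f = (f \<circ> star) \<circ> star" for f :: "'x var \<Rightarrow> nat list" by auto
    then show ?thesis
      unfolding lead_agree_def by (metis evaluation_star)
  qed
  also have "(\<forall>f. evaluation f \<longrightarrow> mset (concat (map f u)) = mset (concat (map f v))) \<longleftrightarrow> mset u = mset v"
  proof
    assume H: "\<forall>f. evaluation f \<longrightarrow> mset (concat (map f u)) = mset (concat (map f v))"
    show "mset u = mset v"
    proof (rule multiset_eqI)
      fix x :: "'x var"
      obtain y where y: "y \<noteq> x" "star x \<noteq> y"
        using ex_fresh_var[of "{x, star x}"] by auto
      \<comment> \<open>\<open>x\<close> becomes 1, \<open>star x\<close> becomes 2 and all else is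
        erased, so the number of 1s in the value is the number of occurrences of
        \<open>x\<close>.\<close>
      let ?f = "pair_eval x [1] y []"
      have "evaluation ?f"
        using y by (intro evaluation_pair_eval) auto
      with H have "count (mset (concat (map ?f u))) 1 = count (mset (concat (map ?f v))) 1"
        by metis
      moreover have "count (mset (concat (map ?f w))) 1 = count (mset w) x" for w
        by (induction w) (auto simp: pair_eval.simps sharp_word_def)
      ultimately show "count (mset u) x = count (mset v) x" by simp
    qed
  next
    assume "mset u = mset v"
    then show "\<forall>f. evaluation f \<longrightarrow> mset (concat (map f u)) = mset (concat (map f v))"
      by (blast intro: mset_concat_map_cong)
  qed
  finally show ?thesis .
qed

text \<open>Split at the first variable whose value contains a 2; if there is none, the first
  summand is already the whole length.\<close>

lemma lead_concat:
  "lead (concat (map f u)) = length (concat (map f (takeWhile (\<lambda>z. 2 \<notin> set (f z)) u))) +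
    (case dropWhile (\<lambda>z. 2 \<notin> set (f z)) u of [] \<Rightarrow> 0 | t # _ \<Rightarrow> lead (f t))"
  by (induction u) (auto simp: lead_append)


section \<open>Words restricted to a pair of variables\<close>

lemma pair_vars_commute: "pair_vars x y = pair_vars y x"
  by (auto simp: pair_vars_def)

lemma pair_vars_eq:
  assumes "s \<in> pair_vars x y" "t \<in> pair_vars x y" "t \<noteq> s" "t \<noteq> star s"
  shows "pair_vars t s = pair_vars x y"
  using assms by (auto simp: pair_vars_def)

lemma restrict_word_cong: "pair_vars x y = pair_vars x' y' \<Longrightarrow> restrict_word u x y = restrict_word u x' y'"
  by (simp add: restrict_word_def)

lemma mset_restrict_word: "mset u = mset v \<Longrightarrow> mset (restrict_word u x y) = mset (restrict_word v x y)"
  by (simp add: restrict_word_def)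

lemma restrict_word_rev: "restrict_word (rev u) x y = rev (restrict_word u x y)"
  by (simp add: restrict_word_def rev_filter)

lemma set_restrict_word: "set (restrict_word u x y) = set u \<inter> pair_vars x y"
  by (auto simp: restrict_word_def)

lemma length_restrict_word: "length (restrict_word u x y) \<le> length u"
  by (simp add: restrict_word_def)

lemma filter_eq_replicate:
  assumes "\<forall>z\<in>set u. z \<noteq> s \<longrightarrow> \<not> P z" "P s"
  shows "filter P u = replicate (count_list u s) s"
  using assms by (induction u) (auto simp flip: Suc_eq_plus1)

lemma takeWhile_append_Cons_eq:
  "\<forall>z\<in>set a. P z \<Longrightarrow> \<not> P t \<Longrightarrow> takeWhile P (a @ t # w) = a"
  by (induction a) auto

lemma replicate_append_Cons_eq:
  assumes "replicate k s @ t # w = replicate j s @ t' # w'" "t \<noteq> s" "t' \<noteq> s"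
  shows "k = j \<and> t = t' \<and> w = w'"
  using assms
proof (induction k arbitrary: j)
  case 0
  then show ?case by (cases j) auto
next
  case (Suc k)
  then show ?case by (cases j) auto
qed

lemma mset_eq_replicate:
  assumes "mset w = mset (replicate k s)"
  shows "w = replicate k s"
proof (rule replicate_eqI)
  show "length w = k" using mset_eq_length[OF assms] by simp
  show "y = s" if "y \<in> set w" for y
    using that mset_eq_setD[OF assms] by (simp split: if_splits)
qed

text \<open>Uniform version of (I)(a) and (II)(a): \<open>s\<close> and \<open>t\<close> are any two
  distinct letters of the pair, and k = 0 is allowed, so that even the first letters agree.\<close>

definition same_first_block :: "'x var list \<Rightarrow> 'x var list \<Rightarrow> bool" where
  "same_first_block u v \<longleftrightarrow> (\<forall>s y k t w. y \<noteq> s \<and> star s \<noteq> y \<and> t \<noteq> s \<and>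
    restrict_word u s y = replicate k s @ t # w \<longrightarrow>
    (\<exists>w'. restrict_word v s y = replicate k s @ t # w'))"

text \<open>A version of (III)(a) symmetric in \<open>u\<close> and \<open>v\<close>, with
  \<open>x\<close>, \<open>y\<close> in the place of their stars; the initial segment may miss one
  or both letters.\<close>

definition same_initial_content :: "'x var list \<Rightarrow> 'x var list \<Rightarrow> bool" where
  "same_initial_content u v \<longleftrightarrow> (\<forall>x y. y \<noteq> x \<and> star x \<noteq> y \<longrightarrow>
    mset (takeWhile (\<lambda>z. z \<in> {x, y}) (restrict_word u x y)) =
    mset (takeWhile (\<lambda>z. z \<in> {x, y}) (restrict_word v x y)))"

lemma same_first_blockD:
  assumes "same_first_block u v" "y \<noteq> s" "star s \<noteq> y" "t \<noteq> s"
    "restrict_word u s y = replicate k s @ t # w"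
  obtains w' where "restrict_word v s y = replicate k s @ t # w'"
  using assms unfolding same_first_block_def by metis

text \<open>The block of \<open>u\<close> carries over to \<open>v\<close> and, block decompositions
  being unique, is the given one. If \<open>u\<close> restricted were a power of \<open>s\<close>,
  balance would make \<open>v\<close> restricted the same power, against the presence of
  \<open>t\<close>.\<close>

lemma same_first_block_sym:
  assumes fb: "same_first_block u v" and m: "mset u = mset v"
  shows "same_first_block v u"
  unfolding same_first_block_def
proof (intro allI impI, elim conjE)
  fix s y t :: "'a var" and k w
  assume *: "y \<noteq> s" "star s \<noteq> y" "t \<noteq> s" and v: "restrict_word v s y = replicate k s @ t # w"
  obtain j r where r: "restrict_word u s y = replicate j s @ r" "r = [] \<or> hd r \<noteq> s"
    using replicate_split .
  show "\<exists>w'. restrict_word u s y = replicate k s @ t # w'"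
  proof (cases r)
    case Nil
    then have "mset (restrict_word v s y) = mset (replicate j s)"
      using r(1) mset_restrict_word[OF m] by (metis append_Nil2)
    then have "restrict_word v s y = replicate j s" by (rule mset_eq_replicate)
    with v have "t \<in> set (replicate j s)" by (metis in_set_conv_decomp)
    with * show ?thesis by simp
  next
    case (Cons t' w')
    with r(2) have "t' \<noteq> s" by simp
    then obtain w'' where "restrict_word v s y = replicate j s @ t' # w''"
      using same_first_blockD[OF fb *(1,2)] r(1) Cons by metis
    with v have "k = j \<and> t = t' \<and> w = w''"
      using replicate_append_Cons_eq * \<open>t' \<noteq> s\<close> by metis
    then show ?thesis using r(1) Cons by blast
  qed
qed

section \<open>From evaluations to restricted words\<close>

lemma concat_pair_eval:
  "concat (map (pair_eval x a y b) u) = concat (map (pair_eval x a y b) (restrict_word u x y))"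
  by (induction u) (auto simp: restrict_word_def pair_vars_def pair_eval.simps)

text \<open>Uniqueness of the last digit in base \<open>N\<close>: with \<open>N\<close> above the
  word lengths, a single lead reports two numbers.\<close>

lemma add_mult_unique:
  fixes N :: nat
  assumes "a + N * b = c + N * d" "a < N" "c < N"
  shows "a = c \<and> b = d"
proof -
  have "a = (a + N * b) mod N" "c = (c + N * d) mod N" using assms(2,3) by simp_all
  then have "a = c" using assms(1) by metis
  with assms show ?thesis by simp
qed

text \<open>Send \<open>s\<close> to 1 and the other three letters of the pair to words that contain
  a 2 and have leads 0, N and 2N. The lead of the whole value is then \<open>k\<close> plus one of
  these, which determines both \<open>k < N\<close> and \<open>t\<close>.\<close>

lemma lead_agree_imp_same_first_block:
  assumes la: "lead_agree u v" and m: "mset u = mset v"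
  shows "same_first_block u v"
  unfolding same_first_block_def
proof (intro allI impI, elim conjE)
  fix s y t :: "'a var" and k w
  assume *: "y \<noteq> s" "star s \<noteq> y" "t \<noteq> s" and u: "restrict_word u s y = replicate k s @ t # w"
  define N where "N = Suc (length u)"
  \<comment> \<open>The involution turns the value of \<open>y\<close> into
    \<open>1^(2N) 2 1 2^N\<close>, so \<open>star s\<close>, \<open>y\<close> and
    \<open>star y\<close> get the leads 0, N and 2N.\<close>
  define f where "f = pair_eval s [1] y (replicate N 1 @ [2, 1] @ replicate (2 * N) 2)"
  have f: "evaluation f"
    unfolding f_def using * by (intro evaluation_pair_eval) (auto simp: lists_le_2_iff)
  have f_s: "f s = [1]" by (simp add: f_def pair_eval.simps)
  have f_star: "f (star s) = [2]" by (simp add: f_def pair_eval.simps sharp_word_def)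
  have f_y: "f y = replicate N 1 @ [2, 1] @ replicate (2 * N) 2"
    using * by (simp add: f_def pair_eval.simps)
  have f_star_y: "f (star y) = replicate (2 * N) 1 @ [2, 1] @ replicate N 2"
    using * by (auto simp: f_def pair_eval.simps sharp_word_def simp flip: One_nat_def)
  define c :: "'a var \<Rightarrow> nat" where
    "c z = (if z = star s then 0 else if z = y then 1 else 2)" for z
  have lead_f: "lead (f z) = N * c z \<and> 2 \<in> set (f z)" if "z \<in> pair_vars s y" "z \<noteq> s" for z
    using that *(1,2) *(2)[symmetric] unfolding pair_vars_def
    by (auto simp: f_star f_y f_star_y c_def lead_append)
  have rep: "concat (replicate k (f s)) = replicate k 1" for k
    by (induction k) (simp_all add: f_s)
  have lead: "lead (concat (map f u')) = k + N * c t"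
    if "restrict_word u' s y = replicate k s @ t # w" "t \<noteq> s" for u' k t w
  proof -
    have "t \<in> pair_vars s y"
      using that(1) set_restrict_word[of u' s y] by auto
    moreover have "concat (map f u') = concat (map f (restrict_word u' s y))"
      unfolding f_def by (rule concat_pair_eval)
    ultimately show ?thesis
      using that lead_f[of t] by (simp add: rep lead_append)
  qed
  obtain j r where r: "restrict_word v s y = replicate j s @ r" "r = [] \<or> hd r \<noteq> s"
    using replicate_split .
  show "\<exists>w'. restrict_word v s y = replicate k s @ t # w'"
  proof (cases r)
    case Nil
    then have "mset (restrict_word u s y) = mset (replicate j s)"
      using r(1) mset_restrict_word[OF m] by (metis append_Nil2)
    then have "restrict_word u s y = replicate j s" by (rule mset_eq_replicate)
    with u have "t \<in> set (replicate j s)" by (metis in_set_conv_decomp)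
    with * show ?thesis by simp
  next
    case (Cons t' w')
    with r have v: "restrict_word v s y = replicate j s @ t' # w'" and t': "t' \<noteq> s" by auto
    have "k + N * c t = j + N * c t'"
      using la f lead[OF u \<open>t \<noteq> s\<close>] lead[OF v t'] unfolding lead_agree_def by simp
    moreover have "k < N" "j < N"
      using length_restrict_word[of u s y] length_restrict_word[of v s y] u v mset_eq_length[OF m]
      by (simp_all add: N_def)
    ultimately have "k = j" "c t = c t'"
      using add_mult_unique by blast+
    moreover have "t \<in> pair_vars s y" "t' \<in> pair_vars s y"
      using u v set_restrict_word[of u s y] set_restrict_word[of v s y] by auto
    ultimately show ?thesis
      using v * t' by (auto simp: c_def pair_vars_def split: if_splits)
  qed
qed

text \<open>With powers of 1 for \<open>x\<close> and \<open>y\<close> and powers of 2 for their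
  stars, the lead is the length of the value of the initial segment over \<open>{x, y}\<close>; the
  lengths 1 and N make it report both occurrence counts.\<close>

lemma lead_agree_imp_same_initial_content:
  assumes la: "lead_agree u v" and m: "mset u = mset v"
  shows "same_initial_content u v"
  unfolding same_initial_content_def
proof (intro allI impI, elim conjE)
  fix x y :: "'a var"
  assume *: "y \<noteq> x" "star x \<noteq> y"
  define N where "N = Suc (length u)"
  define f where "f = pair_eval x [1] y (replicate N 1)"
  let ?a = "\<lambda>u. takeWhile (\<lambda>z. z \<in> {x, y}) (restrict_word u x y)"
  have f: "evaluation f"
    unfolding f_def using * by (intro evaluation_pair_eval) (auto simp: lists_le_2_iff)
  have fs: "f x = [1]" "f y = replicate N 1" "f (star x) = [2]" "f (star y) = replicate N 2"
    using * *(2)[symmetric] by (auto simp: f_def pair_eval.simps sharp_word_def)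
  have len: "length (concat (map f a)) = count_list a x + N * count_list a y"
    if "set a \<subseteq> {x, y}" for a
    using that * by (induction a) (auto simp: fs algebra_simps)
  have sub: "set (?a u) \<subseteq> {x, y}" for u
    by (auto dest: set_takeWhileD)
  have lead: "lead (concat (map f u)) = count_list (?a u) x + N * count_list (?a u) y" for u
  proof -
    have eq: "2 \<notin> set (f z) \<longleftrightarrow> z \<in> {x, y}" if "z \<in> set (restrict_word u x y)" for z
      using that * by (auto simp: set_restrict_word pair_vars_def fs N_def star_eq_swap)
    have a: "takeWhile (\<lambda>z. 2 \<notin> set (f z)) (restrict_word u x y) = ?a u"
      using eq by (intro takeWhile_cong) auto
    have "lead (f t) = 0" if "dropWhile (\<lambda>z. 2 \<notin> set (f z)) (restrict_word u x y) = t # w" for t w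
    proof -
      have "t \<in> set (restrict_word u x y)" "2 \<in> set (f t)"
        using that hd_dropWhile[of "\<lambda>z. 2 \<notin> set (f z)" "restrict_word u x y"]
        by (auto intro: set_dropWhileD[of _ "\<lambda>z. 2 \<notin> set (f z)"])
      then show ?thesis
        using * by (auto simp: set_restrict_word pair_vars_def fs split: if_splits)
    qed
    moreover have "concat (map f u) = concat (map f (restrict_word u x y))"
      unfolding f_def by (rule concat_pair_eval)
    ultimately show ?thesis
      using lead_concat[of f "restrict_word u x y"] len[OF sub[of u]]
      by (simp add: a split: list.splits)
  qed
  have lt: "count_list (?a u') x < N" if "length u' = length u" for u'
    using count_le_length[of "?a u'" x] length_takeWhile_le[of _ "restrict_word u' x y"]
      length_restrict_word[of u' x y] that unfolding N_def
    by (metis le_imp_less_Suc le_trans)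
  have "count_list (?a u) x + N * count_list (?a u) y = count_list (?a v) x + N * count_list (?a v) y"
    using la f lead unfolding lead_agree_def by metis
  then have "count_list (?a u) x = count_list (?a v) x \<and> count_list (?a u) y = count_list (?a v) y"
    using add_mult_unique lt mset_eq_length[OF m] by metis
  moreover have "count_list (?a u') z = 0" if "z \<notin> {x, y}" for u' z
    using that sub[of u'] by (simp add: count_list_0_iff) blast
  ultimately have "count_list (?a u) z = count_list (?a v) z" for z
    by (cases "z \<in> {x, y}") auto
  then show "mset (?a u) = mset (?a v)"
    by (intro multiset_eqI) (simp add: count_mset)
qed

section \<open>From restricted words to evaluations\<close>

lemma same_first_block_key:
  assumes fb: "same_first_block u v" and u: "u = p @ t # q"
    and s: "s \<noteq> t" "star t \<noteq> s" and p: "set p \<inter> pair_vars s t \<subseteq> {s}"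
  obtains w where "restrict_word v s t = replicate (count_list p s) s @ t # w"
proof -
  have "restrict_word p s t = replicate (count_list p s) s"
    unfolding restrict_word_def using p by (intro filter_eq_replicate) (auto simp: pair_vars_def)
  then have "restrict_word u s t = replicate (count_list p s) s @ t # restrict_word q s t"
    by (simp add: u restrict_word_def pair_vars_def)
  then show ?thesis
    using same_first_blockD[OF fb, of t s t] s that by (metis star_eq_swap)
qed

text \<open>Since \<open>t\<close> and \<open>star t\<close> are both marked, neither occurs in
  \<open>p\<close> or \<open>p'\<close>. Pairing \<open>t\<close> with some \<open>s\<close> whose
  star is absent from \<open>p\<close> and \<open>p'\<close> as well leaves only a power of
  \<open>s\<close> there, and block comparison yields the letter behind it and the count of
  \<open>s\<close>.\<close>

lemma first_marked_eq:
  fixes u v :: "'x :: infinite var list"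
  assumes fb: "same_first_block u v"
    and u: "u = p @ t # q" and v: "v = p' @ t' # q'"
    and p: "set p \<inter> T = {}" and p': "set p' \<inter> T = {}"
    and t: "t \<in> T" "star t \<in> T" and t': "t' \<in> T"
  shows "t' = t" and "z \<notin> T \<Longrightarrow> star z \<in> T \<Longrightarrow> count_list p z = count_list p' z"
proof -
  have key: "t' = t \<and> count_list p s = count_list p' s"
    if s: "s \<noteq> t" "star t \<noteq> s" "set p \<inter> pair_vars s t \<subseteq> {s}" "set p' \<inter> pair_vars s t \<subseteq> {s}"
      "t' \<in> pair_vars s t" "t' \<noteq> s" for s
  proof -
    obtain w where w: "restrict_word v s t = replicate (count_list p s) s @ t # w"
      using same_first_block_key[OF fb u s(1-3)] .
    have "restrict_word p' s t = replicate (count_list p' s) s"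
      unfolding restrict_word_def using s(4)
      by (intro filter_eq_replicate) (auto simp: pair_vars_def)
    then have "restrict_word v s t = replicate (count_list p' s) s @ t' # restrict_word q' s t"
      using s(5) by (simp add: v restrict_word_def)
    with w show ?thesis
      using replicate_append_Cons_eq s(1,6) by metis
  qed
  show "t' = t"
  proof (cases "t' \<in> {t, star t}")
    case True
    \<comment> \<open>With a fresh partner the blocks are empty and first letters are
      compared.\<close>
    obtain s where s: "s \<notin> set u \<union> set v \<union> {t, star t}" "star s \<notin> set u \<union> set v \<union> {t, star t}"
      using ex_fresh_var[of "set u \<union> set v \<union> {t, star t}"] by auto
    have "set p \<inter> pair_vars s t \<subseteq> {s}" "set p' \<inter> pair_vars s t \<subseteq> {s}"
      using s p p' t u v by (auto simp: pair_vars_def)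
    then show ?thesis
      using key[of s] s True by (auto simp: pair_vars_def)
  next
    case False
    \<comment> \<open>With the partner \<open>star t'\<close> the pair contains \<open>t'\<close>,
      and of its letters only \<open>star t'\<close> can occur in \<open>p\<close> or
      \<open>p'\<close>.\<close>
    have "set p \<inter> pair_vars (star t') t \<subseteq> {star t'}" "set p' \<inter> pair_vars (star t') t \<subseteq> {star t'}"
      using p p' t t' by (auto simp: pair_vars_def)
    moreover have "star t' \<noteq> t" using False by auto
    ultimately show ?thesis
      using key[of "star t'"] False by (auto simp: pair_vars_def)
  qed
  show "count_list p z = count_list p' z" if z: "z \<notin> T" "star z \<in> T"
  proof -
    have "set p \<inter> pair_vars z t \<subseteq> {z}" "set p' \<inter> pair_vars z t \<subseteq> {z}"
      using p p' t z by (auto simp: pair_vars_def)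
    then show ?thesis
      using key[of z] z t \<open>t' = t\<close> by (auto simp: pair_vars_def)
  qed
qed

text \<open>The initial segment of \<open>u\<close> over \<open>{star t, y}\<close> stops at
  \<open>t\<close>, so it is \<open>p\<close> restricted to the pair. In \<open>v\<close> it covers
  at least \<open>p'\<close> restricted, but may go on, as \<open>t'\<close> may lie outside the
  pair; hence only an inequality.\<close>

lemma first_marked_count_le:
  fixes u v :: "'x :: infinite var list"
  assumes ic: "same_initial_content u v"
    and u: "u = p @ t # q" and v: "v = p' @ t' # q'"
    and p: "set p \<inter> T = {}" and p': "set p' \<inter> T = {}"
    and t: "t \<in> T" and z: "z \<notin> T" "star z \<in> T"
  shows "count_list p' z \<le> count_list p z"
proof -
  have key: "count_list p' z \<le> count_list p z"
    if y: "y \<noteq> t" "y \<noteq> star t" "star y \<notin> set p" "star y \<notin> set p'" and z: "z \<in> {star t, y}" for y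
  proof -
    let ?P = "\<lambda>z. z \<in> {star t, y}"
    have tp: "t \<notin> set p" "t \<notin> set p'" using p p' t by auto
    have *: "\<forall>z\<in>set (restrict_word a (star t) y). ?P z"
      if "t \<notin> set a" "star y \<notin> set a" for a
      using that by (auto simp: set_restrict_word pair_vars_def)
    have "takeWhile ?P (restrict_word u (star t) y) = restrict_word p (star t) y"
    proof -
      have "restrict_word u (star t) y = restrict_word p (star t) y @ t # restrict_word q (star t) y"
        by (simp add: u restrict_word_def pair_vars_def)
      then show ?thesis
        using *[OF tp(1) y(3)] y by (simp add: takeWhile_append2)
    qed
    moreover have "\<exists>r. takeWhile ?P (restrict_word v (star t) y) = restrict_word p' (star t) y @ r"
    proof -
      have "restrict_word v (star t) y = restrict_word p' (star t) y @ restrict_word (t' # q') (star t) y"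
        by (simp add: v restrict_word_def)
      then show ?thesis
        using *[OF tp(2) y(4)] by (simp add: takeWhile_append2)
    qed
    moreover have "mset (takeWhile ?P (restrict_word u (star t) y)) =
        mset (takeWhile ?P (restrict_word v (star t) y))"
      using ic y(1,2) unfolding same_initial_content_def by auto
    ultimately have "mset (restrict_word p' (star t) y) \<subseteq># mset (restrict_word p (star t) y)"
      by (auto simp: mset_subset_eq_add_left)
    then have "count (mset (restrict_word p' (star t) y)) z \<le> count (mset (restrict_word p (star t) y)) z"
      by (rule mset_subset_eq_count)
    then show ?thesis
      using z by (auto simp: restrict_word_def pair_vars_def count_mset)
  qed
  show ?thesis
  \<comment> \<open>For \<open>z = star t\<close> the partner \<open>y\<close> is fresh; otherwise
    it is \<open>z\<close> itself.\<close>
  proof (cases "z = star t")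
    case True
    obtain y where "y \<notin> set p \<union> set p' \<union> {t, star t}" "star y \<notin> set p \<union> set p' \<union> {t, star t}"
      using ex_fresh_var[of "set p \<union> set p' \<union> {t, star t}"] by auto
    then show ?thesis using key[of y] True by auto
  next
    case False
    moreover have "z \<noteq> t" "star z \<notin> set p" "star z \<notin> set p'" using z t p p' by auto
    ultimately show ?thesis using key[of z] by auto
  qed
qed

lemma split_first_marked:
  assumes "set u \<inter> T \<noteq> {}"
  obtains p t q where "u = p @ t # q" "set p \<inter> T = {}" "t \<in> T"
  using assms split_list_first_prop[of u "\<lambda>z. z \<in> T"] by blast

lemma same_first_block_imp_lead_agree:
  fixes u v :: "'x :: infinite var list"
  assumes fb: "same_first_block u v" and ic: "same_initial_content u v" and m: "mset u = mset v"
  shows "lead_agree u v"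
  unfolding lead_agree_def
proof (intro allI impI)
  fix f :: "'x var \<Rightarrow> nat list" assume f: "evaluation f"
  define T where "T = {z. 2 \<in> set (f z)}"
  have f12: "set (f z) \<subseteq> {1, 2}" and f_star: "f (star z) = sharp_word 2 (f z)" for z
    using f unfolding evaluation_def lists_le_2_iff by blast+
  have star_T: "star z \<in> T \<longleftrightarrow> 1 \<in> set (f z)" for z
    using f12[of z] unfolding T_def f_star set_sharp_word mem_Collect_eq by force
  show "lead (concat (map f u)) = lead (concat (map f v))"
  proof (cases "set u \<inter> T = {}")
    case True
    moreover have "set v = set u" using m by (metis mset_eq_setD)
    ultimately have "2 \<notin> set (concat (map f u))" "2 \<notin> set (concat (map f v))"
      by (auto simp: T_def)
    then have "lead (concat (map f u)) = length (concat (map f u))"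
      "lead (concat (map f v)) = length (concat (map f v))"
      by (auto intro: lead_eq_length)
    moreover have "mset (concat (map f u)) = mset (concat (map f v))"
      using m by (rule mset_concat_map_cong)
    ultimately show ?thesis by (metis mset_eq_length)
  next
    case False
    obtain p t q where u: "u = p @ t # q" and p: "set p \<inter> T = {}" and t: "t \<in> T"
      using split_first_marked[OF False] .
    have "set v \<inter> T \<noteq> {}" using False m by (metis mset_eq_setD)
    then obtain p' t' q' where v: "v = p' @ t' # q'" and p': "set p' \<inter> T = {}" and t': "t' \<in> T"
      using split_first_marked by metis
    have fb': "same_first_block v u" using same_first_block_sym[OF fb m] .
    have ic': "same_initial_content v u" using ic unfolding same_initial_content_def by metis
    \<comment> \<open>Used in both directions: if the star of \<open>t\<close> or of
      \<open>t'\<close> is marked, the two coincide.\<close>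
    have t_eq: "t' = t \<or> star t \<notin> T \<and> star t' \<notin> T"
      using first_marked_eq(1)[OF fb u v p p' t _ t'] first_marked_eq(1)[OF fb' v u p' p t' _ t] by blast
    have count: "count_list p z = count_list p' z" if "z \<notin> T" "star z \<in> T" for z
    proof (cases "star t \<in> T")
      case True
      then show ?thesis using first_marked_eq(2)[OF fb u v p p' t _ t'] that by blast
    next
      case False
      then show ?thesis
        using first_marked_count_le[OF ic u v p p' t] first_marked_count_le[OF ic' v u p' p t'] that
        by (metis le_antisym)
    qed
    \<comment> \<open>If \<open>star t\<close> is unmarked, the value of \<open>t\<close> has no 1,
      so its lead is 0.\<close>
    have lead_t: "lead (f t) = lead (f t')"
    proof -
      have "lead (f t) = 0" if "star t \<notin> T" for t
      proof (cases "f t")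
        case (Cons i w)
        then have "i = 2" using that f12[of t] by (auto simp: star_T)
        then show ?thesis using Cons by simp
      qed simp
      then show ?thesis using t_eq by metis
    qed
    \<comment> \<open>Counts in \<open>p\<close> and \<open>p'\<close> are known to agree for
      variables whose value contains 1 but no 2. The other variables in \<open>p\<close> and
      \<open>p'\<close> have empty value, hence the filter.\<close>
    let ?F = "filter (\<lambda>z. f z \<noteq> [])"
    have "mset (?F p) = mset (?F p')"
    proof (rule multiset_eqI)
      fix z
      consider "z \<in> T" | "f z = []" | "z \<notin> T" "star z \<in> T"
        using f12[of z] unfolding star_T unfolding T_def by (cases "f z") auto
      then show "count (mset (?F p)) z = count (mset (?F p')) z"
      proof cases
        case 1
        then have "z \<notin> set p" "z \<notin> set p'" using p p' by auto
        then show ?thesis by (simp add: count_mset count_list_0_iff)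
      qed (simp_all add: count_mset count)
    qed
    then have "mset (concat (map f (?F p))) = mset (concat (map f (?F p')))"
      by (rule mset_concat_map_cong)
    moreover have "concat (map f (?F a)) = concat (map f a)" for a
      by (induction a) auto
    ultimately have "length (concat (map f p)) = length (concat (map f p'))"
      using mset_eq_length by metis
    moreover have "2 \<notin> set (concat (map f p))" "2 \<notin> set (concat (map f p'))"
      using p p' by (auto simp: T_def)
    ultimately show ?thesis
      using t t' lead_t by (simp add: u v lead_append T_def)
  qed
qed


section \<open>The conditions on pairs of variables\<close>

text \<open>The halves (a), with the remainders existentially quantified; the halves (b) are
  recovered by reversing both words.\<close>

definition left_conds :: "'x var list \<Rightarrow> 'x var list \<Rightarrow> 'x var \<Rightarrow> 'x var \<Rightarrow> bool" where
  "left_conds u v x y \<longleftrightarrow>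
    (\<forall>k\<ge>1. (\<exists>w. restrict_word u x y = replicate k x @ star x # w) \<longrightarrow>
      (\<exists>w. restrict_word v x y = replicate k x @ star x # w)) \<and>
    (\<forall>k\<ge>1. (\<exists>w. restrict_word u x y = replicate k y @ x # w) \<longrightarrow>
      (\<exists>w. restrict_word v x y = replicate k y @ x # w)) \<and>
    (\<forall>a. set a = {star x, star y} \<and> (\<exists>w. restrict_word u x y = a @ x # w) \<longrightarrow>
      (\<exists>a' t w. mset a' = mset a \<and> t \<in> {x, y} \<and> restrict_word v x y = a' @ t # w))"

section \<open>The conditions as statements about prefixes\<close>

lemma permutation_of_iff: "permutation_of a' a \<longleftrightarrow> mset a' = mset a"
  unfolding permutation_of_def multiset_eq_iff count_mset by metis

lemma balanced_iff: "balanced u v \<longleftrightarrow> mset u = mset v"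
proof -
  have "balanced u v \<longleftrightarrow> (\<forall>x. count_list u x = count_list v x)"
    unfolding balanced_def by (auto simp: count_list_0_iff)
  then show ?thesis by (simp add: multiset_eq_iff count_mset)
qed

lemma with_prefix_iff:
  "restrict_word u x y \<in> with_prefix p (pair_vars x y) \<longleftrightarrow> (\<exists>w. restrict_word u x y = p @ w)"
proof -
  have "w \<in> lists (pair_vars x y)" if "restrict_word u x y = p @ w" for w
  proof -
    have "set w \<subseteq> set (restrict_word u x y)" using that by auto
    then show ?thesis unfolding set_restrict_word by auto
  qed
  then show ?thesis by (auto simp: with_prefix_def)
qed

lemma with_suffix_iff:
  "restrict_word u x y \<in> with_suffix (pair_vars x y) s \<longleftrightarrow>
    (\<exists>w. restrict_word (rev u) x y = rev s @ w)"
proof -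
  have "w \<in> lists (pair_vars x y)" if "restrict_word u x y = w @ s" for w
  proof -
    have "set w \<subseteq> set (restrict_word u x y)" using that by auto
    then show ?thesis unfolding set_restrict_word by auto
  qed
  then have "restrict_word u x y \<in> with_suffix (pair_vars x y) s \<longleftrightarrow> (\<exists>w. restrict_word u x y = w @ s)"
    by (auto simp: with_suffix_def)
  also have "\<dots> \<longleftrightarrow> (\<exists>w. rev (restrict_word u x y) = rev s @ w)"
    by (metis rev_append rev_rev_ident)
  finally show ?thesis by (simp add: restrict_word_rev)
qed

text \<open>Reversal turns suffixes into prefixes and fixes powers; in (III) it reverses
  \<open>a\<close> and \<open>a'\<close>, which changes neither their sets nor their
  multisets.\<close>

lemma conds_iff_left_conds:
  "cond_I u v x y \<and> cond_II u v x y \<and> cond_III u v x y \<longleftrightarrow>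
    left_conds u v x y \<and> left_conds (rev u) (rev v) x y"
proof -
  have III: "(\<forall>a. set a = A \<and> (\<exists>w. R = rev (x # a) @ w) \<longrightarrow>
      (\<exists>a'. mset a' = mset a \<and> ((\<exists>w. R' = rev (x # a') @ w) \<or> (\<exists>w. R' = rev (y # a') @ w)))) \<longleftrightarrow>
    (\<forall>a. set a = A \<and> (\<exists>w. R = a @ x # w) \<longrightarrow>
      (\<exists>a' t w. mset a' = mset a \<and> t \<in> {x, y} \<and> R' = a' @ t # w))" (is "?L \<longleftrightarrow> ?R")
    for A and R R' :: "'a var list"
  proof
    assume L: ?L
    show ?R
    proof (intro allI impI)
      fix a assume "set a = A \<and> (\<exists>w. R = a @ x # w)"
      then obtain a' where "mset a' = mset a" "(\<exists>w. R' = rev (x # a') @ w) \<or> (\<exists>w. R' = rev (y # a') @ w)"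
        using L[rule_format, of "rev a"] by auto
      then show "\<exists>a' t w. mset a' = mset a \<and> t \<in> {x, y} \<and> R' = a' @ t # w"
        by (intro exI[of _ "rev a'"]) auto
    qed
  next
    assume R: ?R
    show ?L
    proof (intro allI impI)
      fix a assume "set a = A \<and> (\<exists>w. R = rev (x # a) @ w)"
      then obtain a' t w where "mset a' = mset a" "t \<in> {x, y}" "R' = a' @ t # w"
        using R[rule_format, of "rev a"] by auto
      then show "\<exists>a'. mset a' = mset a \<and>
          ((\<exists>w. R' = rev (x # a') @ w) \<or> (\<exists>w. R' = rev (y # a') @ w))"
        by (intro exI[of _ "rev a'"]) auto
    qed
  qed
  have III': "(\<exists>a'. mset a' = mset a \<and> ((\<exists>w. R' = (a' @ [x]) @ w) \<or> (\<exists>w. R' = (a' @ [y]) @ w))) \<longleftrightarrow>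
      (\<exists>a' t w. mset a' = mset a \<and> t \<in> {x, y} \<and> R' = a' @ t # w)" for a R'
    by auto
  show ?thesis
    unfolding cond_I_def cond_II_def cond_III_def left_conds_def with_prefix_iff with_suffix_iff
      permutation_of_iff III' append_Cons append_Nil III
    by simp blast
qed

text \<open>(I) and (II) compare blocks of \<open>x\<close> and of \<open>y\<close>. For (III)
  compare initial contents over \<open>star x\<close>, \<open>star y\<close>: by balance
  \<open>v\<close> restricted is longer than its initial segment, and the letter that ends the
  segment can only be \<open>x\<close> or \<open>y\<close>.\<close>

lemma same_first_block_imp_left_conds:
  assumes fb: "same_first_block u v" and ic: "same_initial_content u v" and m: "mset u = mset v"
    and xy: "y \<noteq> x" "star x \<noteq> y"
  shows "left_conds u v x y"
  unfolding left_conds_def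
proof (intro conjI allI impI)
  fix k assume "\<exists>w. restrict_word u x y = replicate k x @ star x # w"
  then show "\<exists>w. restrict_word v x y = replicate k x @ star x # w"
    using same_first_blockD[OF fb xy] by (metis star_neq(1))
next
  fix k assume "\<exists>w. restrict_word u x y = replicate k y @ x # w"
  moreover have "restrict_word u y x = restrict_word u x y" for u
    by (rule restrict_word_cong) (rule pair_vars_commute)
  ultimately show "\<exists>w. restrict_word v x y = replicate k y @ x # w"
    using same_first_blockD[OF fb, of x y x] xy by (metis star_eq_swap)
next
  fix a assume a: "set a = {star x, star y} \<and> (\<exists>w. restrict_word u x y = a @ x # w)"
  then obtain w where w: "restrict_word u x y = a @ x # w" by blast
  let ?P = "\<lambda>z. z \<in> {star x, star y}"
  let ?a = "takeWhile ?P (restrict_word v x y)"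
  have r: "restrict_word u (star x) (star y) = restrict_word u x y" for u
    by (rule restrict_word_cong) (auto simp: pair_vars_def)
  have "takeWhile ?P (restrict_word u x y) = a"
    unfolding w by (rule takeWhile_append_Cons_eq) (use a xy in auto)
  moreover have "mset (takeWhile ?P (restrict_word u x y)) = mset ?a"
    using ic xy r unfolding same_initial_content_def by (metis star_eq_star star_star)
  ultimately have a': "mset ?a = mset a" by simp
  have "length ?a < length (restrict_word v x y)"
    using mset_eq_length[OF a'] w mset_eq_length[OF mset_restrict_word[OF m]] by (metis length_append add_less_cancel_left length_Cons less_add_same_cancel1 zero_less_Suc)
  then have ne: "dropWhile ?P (restrict_word v x y) \<noteq> []"
    by (metis append_Nil2 nat_neq_iff takeWhile_dropWhile_id)
  then obtain t w' where t: "dropWhile ?P (restrict_word v x y) = t # w'"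
    by (meson neq_Nil_conv)
  then have "\<not> ?P t" using hd_dropWhile[OF ne] by simp
  moreover have "t \<in> pair_vars x y"
    using t set_restrict_word[of v x y] by (metis IntD2 list.set_intros(1) set_dropWhileD)
  ultimately have "t \<in> {x, y}" by (auto simp: pair_vars_def)
  then show "\<exists>a' t w. mset a' = mset a \<and> t \<in> {x, y} \<and> restrict_word v x y = a' @ t # w"
    using a' t by (metis takeWhile_dropWhile_id)
qed

text \<open>As \<open>k\<close> is positive, both letters occur in \<open>u\<close> and either may
  play the role of \<open>x\<close>: for \<open>t = star s\<close> use (I) at \<open>s\<close>,
  otherwise (II) at \<open>t\<close> with block letter \<open>s\<close>.\<close>

lemma left_conds_imp_same_block:
  assumes lc: "\<And>x y. x \<in> set u \<Longrightarrow> y \<noteq> x \<Longrightarrow> star x \<noteq> y \<Longrightarrow> left_conds u v x y"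
    and xy: "y \<noteq> x" "star x \<noteq> y" and k: "k \<ge> 1" and t: "t \<noteq> s"
    and u: "restrict_word u x y = replicate k s @ t # w"
  shows "\<exists>w'. restrict_word v x y = replicate k s @ t # w'"
proof -
  have "s \<in> set (restrict_word u x y)" "t \<in> set (restrict_word u x y)"
    using u k by auto
  then have s: "s \<in> pair_vars x y" "s \<in> set u" and t': "t \<in> pair_vars x y" "t \<in> set u"
    by (auto simp: set_restrict_word)
  show ?thesis
  proof (cases "t = star s")
    case True
    define y' where "y' = (if s \<in> {x, star x} then y else x)"
    have y': "y' \<noteq> s" "star s \<noteq> y'" and p: "pair_vars s y' = pair_vars x y"
      using s xy by (auto simp: y'_def pair_vars_def)
    show ?thesis
      using lc[OF s(2) y'] u k True restrict_word_cong[OF p] unfolding left_conds_def by metis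
  next
    case False
    have p: "pair_vars t s = pair_vars x y" using pair_vars_eq[OF s(1) t'(1) t False] .
    have "s \<noteq> t" "star t \<noteq> s" using t False by auto
    then show ?thesis
      using lc[OF t'(2), of s] u k restrict_word_cong[OF p] unfolding left_conds_def by metis
  qed
qed

lemma left_conds_imp_same_first_block:
  assumes lc: "\<And>x y. x \<in> set u \<Longrightarrow> y \<noteq> x \<Longrightarrow> star x \<noteq> y \<Longrightarrow> left_conds u v x y"
    and m: "mset u = mset v"
  shows "same_first_block u v"
  unfolding same_first_block_def
proof (intro allI impI, elim conjE)
  fix s y t :: "'a var" and k w
  assume *: "y \<noteq> s" "star s \<noteq> y" "t \<noteq> s" and u: "restrict_word u s y = replicate k s @ t # w"
  show "\<exists>w'. restrict_word v s y = replicate k s @ t # w'"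
  proof (cases "k = 0")
    case False
    then show ?thesis using left_conds_imp_same_block[OF lc *(1,2) _ *(3) u] by auto
  next
    case True
    \<comment> \<open>The conditions speak about nonempty blocks. For k = 0 the word starts with
      \<open>t\<close>, so the maximal block of \<open>t\<close> is compared instead; if it is the
      whole word, balance suffices.\<close>
    obtain j r where r: "restrict_word u s y = replicate j t @ r" "r = [] \<or> hd r \<noteq> t"
      using replicate_split .
    have "j \<noteq> 0" using r u True by (cases j) auto
    show ?thesis
    proof (cases r)
      case Nil
      then have "mset (restrict_word v s y) = mset (replicate j t)"
        using r(1) mset_restrict_word[OF m] by (metis append_Nil2)
      then have "restrict_word v s y = replicate j t" by (rule mset_eq_replicate)
      then show ?thesis using True \<open>j \<noteq> 0\<close> by (cases j) auto
    next
      case (Cons t' r')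
      with r have "t' \<noteq> t" by simp
      then show ?thesis
        using left_conds_imp_same_block[OF lc *(1,2), of j t' t r'] r Cons True \<open>j \<noteq> 0\<close>
        by (cases j) auto
    qed
  qed
qed

text \<open>The initial segment over \<open>{x, y}\<close> is the whole restricted word, settled by
  balance, or contains both letters, settled by (III), or at most one, settled by block
  comparison.\<close>

lemma left_conds_imp_same_initial_content:
  assumes lc: "\<And>x y. x \<in> set u \<Longrightarrow> y \<noteq> x \<Longrightarrow> star x \<noteq> y \<Longrightarrow> left_conds u v x y"
    and m: "mset u = mset v"
  shows "same_initial_content u v"
  unfolding same_initial_content_def
proof (intro allI impI, elim conjE)
  fix x y :: "'a var"
  assume xy: "y \<noteq> x" "star x \<noteq> y"
  let ?P = "\<lambda>z. z \<in> {x, y}"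
  let ?u = "restrict_word u x y" and ?v = "restrict_word v x y"
  have fb: "same_first_block u v" using left_conds_imp_same_first_block[OF lc m] .
  have mr: "mset ?u = mset ?v" by (rule mset_restrict_word[OF m])
  let ?a = "takeWhile ?P ?u"
  show "mset ?a = mset (takeWhile ?P ?v)"
  proof (cases "dropWhile ?P ?u")
    case Nil
    then have "\<forall>z\<in>set ?u. ?P z" by (simp add: dropWhile_eq_Nil_conv)
    moreover from this have "\<forall>z\<in>set ?v. ?P z" using mset_eq_setD[OF mr] by simp
    ultimately show ?thesis using mr by (metis takeWhile_eq_all_conv)
  next
    case (Cons t w)
    have u: "?u = ?a @ t # w" using Cons by (metis takeWhile_dropWhile_id)
    have nt: "\<not> ?P t" using Cons unfolding dropWhile_eq_Cons_conv by blast
    have "t \<in> set ?u" by (subst u) simp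
    then have t: "t \<in> set u" "t \<in> {star x, star y}"
      using nt by (auto simp: set_restrict_word pair_vars_def)
    have sub: "set ?a \<subseteq> {x, y}" by (auto dest: set_takeWhileD)
    show ?thesis
    proof (cases "set ?a = {x, y}")
      case True
      \<comment> \<open>Chosen with \<open>{t, y'} = {star x, star y}\<close>, so that (III) for
        \<open>t\<close>, \<open>y'\<close> speaks about prefixes with content
        \<open>{x, y}\<close>.\<close>
      define y' where "y' = (if t = star x then star y else star x)"
      have y': "{star t, star y'} = {x, y}" "y' \<noteq> t" "star t \<noteq> y'" and p: "pair_vars t y' = pair_vars x y"
        using t(2) xy by (auto simp: y'_def pair_vars_def)
      obtain a' t' w' where a': "mset a' = mset ?a" "t' \<in> {t, y'}" "?v = a' @ t' # w'"
        using lc[OF t(1) y'(2,3)] u True y'(1) restrict_word_cong[OF p] unfolding left_conds_def by metis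
      have "set a' = {x, y}" using mset_eq_setD[OF a'(1)] True by simp
      \<comment> \<open>Whichever of \<open>t\<close>, \<open>y'\<close> follows \<open>a'\<close>
        lies outside \<open>{x, y}\<close>, so \<open>a'\<close> is the full initial
        segment.\<close>
      moreover have "\<not> ?P t'" using a'(2) nt t(2) xy by (auto simp: y'_def)
      ultimately have "takeWhile ?P ?v = a'"
        using takeWhile_append_Cons_eq[of a' ?P t' w'] unfolding a'(3) by blast
      then show ?thesis using a'(1) by simp
    next
      case False
      then have "set ?a \<subseteq> {x} \<or> set ?a \<subseteq> {y}" using sub by blast
      then obtain s s' where s: "{s, s'} = {x, y}" "set ?a \<subseteq> {s}"
      proof
        assume "set ?a \<subseteq> {x}"
        then show thesis by (rule that[of x y, OF HOL.refl])
      next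
        assume "set ?a \<subseteq> {y}"
        then show thesis by (rule that[of y x, OF insert_commute])
      qed
      then have "?a = replicate (length ?a) s" by (intro replicate_eqI) auto
      then obtain k where a: "?a = replicate k s" ..
      have ss: "s' \<noteq> s" "star s \<noteq> s'" "pair_vars s s' = pair_vars x y"
        using s(1) xy by (auto simp: doubleton_eq_iff pair_vars_def)
      have "t \<noteq> s" using nt s(1) by auto
      moreover have "restrict_word u s s' = replicate k s @ t # w"
        using u unfolding restrict_word_cong[OF ss(3)] a .
      ultimately obtain w' where "restrict_word v s s' = replicate k s @ t # w'"
        using same_first_blockD[OF fb ss(1,2)] by blast
      then have v: "?v = ?a @ t # w'" unfolding a restrict_word_cong[OF ss(3)] .
      have "takeWhile ?P ?v = ?a"
        unfolding v by (rule takeWhile_append_Cons_eq) (use sub nt in blast)+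
      then show ?thesis by simp
    qed
  qed
qed

lemma lead_agree_iff_left_conds:
  fixes u v :: "'x :: infinite var list"
  assumes "mset u = mset v"
  shows "lead_agree u v \<longleftrightarrow> (\<forall>x\<in>set u. \<forall>y. x \<noteq> y \<and> star x \<noteq> y \<longrightarrow> left_conds u v x y)"
proof
  assume "lead_agree u v"
  then show "\<forall>x\<in>set u. \<forall>y. x \<noteq> y \<and> star x \<noteq> y \<longrightarrow> left_conds u v x y"
    using assms by (blast intro: same_first_block_imp_left_conds lead_agree_imp_same_first_block
        lead_agree_imp_same_initial_content)
next
  assume "\<forall>x\<in>set u. \<forall>y. x \<noteq> y \<and> star x \<noteq> y \<longrightarrow> left_conds u v x y"
  then have "\<And>x y. x \<in> set u \<Longrightarrow> y \<noteq> x \<Longrightarrow> star x \<noteq> y \<Longrightarrow> left_conds u v x y"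
    by metis
  then show "lead_agree u v"
    using assms left_conds_imp_same_first_block left_conds_imp_same_initial_content
      same_first_block_imp_lead_agree by metis
qed

theorem theorem4p2:
  fixes u v :: "'x :: {countable, infinite} var list"
  assumes "u \<noteq> []" and "v \<noteq> []"
  shows "identity_holds (baxt 2) (baxt_sharp 2) u v \<longleftrightarrow>
    balanced u v \<and>
    (\<forall>x \<in> set u. \<forall>y. x \<noteq> y \<and> star x \<noteq> y \<longrightarrow>
      cond_I u v x y \<and> cond_II u v x y \<and> cond_III u v x y)"
proof (cases "mset u = mset v")
  case True
  then have "mset (rev u) = mset (rev v)" by simp
  from lead_agree_iff_left_conds[OF this] lead_agree_iff_left_conds[OF True] True show ?thesis
    unfolding conds_iff_left_conds identity_holds_iff_lead_agree balanced_iff by auto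
qed (simp add: identity_holds_iff_lead_agree balanced_iff)

end
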